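(* For $x=(x_0,\dots,x_7)\in\mathbb R_{\ge 0}^8$ let $h^-(x)$ and $h^+(x)$ be the left- and right-hand sides of the 3-dimensional Hypercube Inequality $h^-(x)\le h^+(x)$ (defined explicitly in the context). Then equality $h^-(x)=h^+(x)$ holds if and only if for at least one of the six facets $F$ of the cube, i.e. at least one of the index sets $$\{0,1,2,3\},\ \{4,5,6,7\},\ \{0,2,4,6\},\ \{1,3,5,7\},\ \{0,1,4,5\},\ \{2,3,6,7\},$$ one has $x_i=0$ for all $i\in F$. Moreover, the inequality is tight: there is no constant $0<c<1$ such that $h^-(x)\le c\,h^+(x)$ for all $x\in\mathbb R_{\ge 0}^8$.
   Context: The variables $x_0,\dots,x_7$ correspond to the vertices of the 3-dimensional cube, whose facets are given by the listed index sets. Here $$\begin{aligned} h^-(x)=\Bigl(\sum_{i=0}^{7}x_i\Bigr)^2\Bigl[&\Bigl(\sum_{i=0}^{3}x_i\Bigr)\Bigl(\sum_{4\le i<j<k\le 7}x_ix_jx_k\Bigr)+\Bigl(\sum_{i=4}^{7}x_i\Bigr)\Bigl(\sum_{0\le i<j<k\le 3}x_ix_jx_k\Bigr)\\ &+(x_0+x_1)(x_2+x_3)(x_4x_5+x_6x_7)+(x_0+x_2)(x_1+x_3)(x_4x_6+x_5x_7)\\ &+(x_0+x_3)(x_1+x_2)(x_5x_6+x_4x_7)+2x_0x_3x_5x_6+2x_1x_2x_4x_7\Bigr], \end{aligned}$$ $$h^+(x)=\Bigl(\sum_{i=0}^{3}x_i\Bigr)\Bigl(\sum_{i=4}^{7}x_i\Bigr)\Bigl(\sum_{i\in\{0,2,4,6\}}x_i\Bigr)\Bigl(\sum_{i\in\{1,3,5,7\}}x_i\Bigr)\Bigl(\sum_{i\in\{0,1,4,5\}}x_i\Bigr)\Bigl(\sum_{i\in\{2,3,6,7\}}x_i\Bigr).$$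 *)

theory Defs
  imports "HOL-Analysis.Analysis"
begin

text \<open>
  The elements of the index type \<^typ>\<open>8\<close> are the numerals \<open>0, \<dots>, 7\<close>, and its library order is
  \<open>0 < 1 < \<dots> < 7\<close>, so intervals and ordered triples of indices mean what they do for
  natural numbers; the lemmas below confirm this for the index sets used.
\<close>

lemma UNIV_8: "(UNIV::8 set) = {0,1,2,3,4,5,6,7}"
  by (rule sym, rule card_subset_eq) simp_all

lemma Rep_8: "Rep_bit0 (0::8) = 0" "Rep_bit0 (1::8) = 1" "Rep_bit0 (numeral w::8) = numeral w mod 8"
  using bit0.Rep_numeral[where 'a=4, of w] by (simp_all add: bit0.Rep_0 bit0.Rep_1)

lemma all_8: "(\<forall>i::8. P i) \<longleftrightarrow> P 0 \<and> P 1 \<and> P 2 \<and> P 3 \<and> P 4 \<and> P 5 \<and> P 6 \<and> P 7"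
proof -
  have "(\<forall>i::8. P i) = (\<forall>i\<in>{0,1,2,3,4,5,6,7}. P i)" using UNIV_8 by blast
  then show ?thesis by simp
qed

lemma intervals_8: "{0..7::8} = {0,1,2,3,4,5,6,7}" "{0..3::8} = {0,1,2,3}" "{4..7::8} = {4,5,6,7}"
  unfolding set_eq_iff all_8 by (simp_all add: less_eq_bit0_def less_bit0_def Rep_8)

lemma triples_upper_8:
  "{(i::8,j,k). 4 \<le> i \<and> i < j \<and> j < k \<and> k \<le> 7} = {(4,5,6),(4,5,7),(4,6,7),(5,6,7)}"
  unfolding set_eq_iff split_paired_All all_8 by (simp add: less_eq_bit0_def less_bit0_def Rep_8)

lemma triples_lower_8:
  "{(i::8,j,k). 0 \<le> i \<and> i < j \<and> j < k \<and> k \<le> 3} = {(0,1,2),(0,1,3),(0,2,3),(1,2,3)}"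
  unfolding set_eq_iff split_paired_All all_8 by (simp add: less_eq_bit0_def less_bit0_def Rep_8)

definition cube_facets :: "8 set set" where
  "cube_facets =
     {{0,1,2,3}, {4,5,6,7}, {0,2,4,6}, {1,3,5,7}, {0,1,4,5}, {2,3,6,7}}"

definition h_minus :: "real^8 \<Rightarrow> real" where
  "h_minus x =
     (\<Sum>i\<in>{0..7}. x$i)\<^sup>2 *
     ((\<Sum>i\<in>{0..3}. x$i) *
        (\<Sum>(i,j,k)\<in>{(i,j,k). 4 \<le> i \<and> i < j \<and> j < k \<and> k \<le> 7}. x$i * x$j * x$k)
      + (\<Sum>i\<in>{4..7}. x$i) *
        (\<Sum>(i,j,k)\<in>{(i,j,k). 0 \<le> i \<and> i < j \<and> j < k \<and> k \<le> 3}. x$i * x$j * x$k)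
      + (x$0 + x$1) * (x$2 + x$3) * (x$4 * x$5 + x$6 * x$7)
      + (x$0 + x$2) * (x$1 + x$3) * (x$4 * x$6 + x$5 * x$7)
      + (x$0 + x$3) * (x$1 + x$2) * (x$5 * x$6 + x$4 * x$7)
      + 2 * x$0 * x$3 * x$5 * x$6
      + 2 * x$1 * x$2 * x$4 * x$7)"

definition h_plus :: "real^8 \<Rightarrow> real" where
  "h_plus x =
     (\<Sum>i\<in>{0..3}. x$i) * (\<Sum>i\<in>{4..7}. x$i) *
     (\<Sum>i\<in>{0,2,4,6}. x$i) * (\<Sum>i\<in>{1,3,5,7}. x$i) *
     (\<Sum>i\<in>{0,1,4,5}. x$i) * (\<Sum>i\<in>{2,3,6,7}. x$i)"

end

theory Submission
  imports Defs
begin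

text \<open>
  Regard \<open>x\<close> as a measure of total mass \<open>s\<close> on the vertices of the cube, so that the three
  coordinates become \<open>0/1\<close>-valued random variables. Up to powers of \<open>s\<close>, by Cauchy-Binet, the determinant
  of their covariance matrix is the sum over the nondegenerate tetrahedra of the
  squared normalised volume times the product of the four weights; \<open>h_minus\<close> is the same sum with
  unsquared volumes, which differs only at the two large tetrahedra \<open>{0,3,5,6}\<close> and \<open>{1,2,4,7}\<close>
  (volume 2). Since \<open>h_plus\<close> is the product of the variances, the inequality follows from
  Hadamard's. In case of equality with positive variances the coordinates are pairwise
  independent, so that each \<open>x i\<close> differs from the product of its marginals by \<open>t\<close>, with a sign given
  by the parity of the vertex; but equality also forces a zero weight in each large tetrahedron,
  hence both \<open>t > 0\<close> and \<open>t < 0\<close>.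
\<close>

text \<open>The right-hand side is the defect in Hadamard's inequality for a symmetric matrix with
  diagonal \<open>u\<close>, \<open>v\<close>, \<open>w\<close>. Its part without \<open>w\<close>
  is a quadratic form in \<open>a\<close>, \<open>b\<close>, positive semidefinite by the
  assumptions.\<close>

lemma hadamard_gap_3:
  fixes u v w a b c :: real
  assumes "0 \<le> u" "0 \<le> v" and c: "c\<^sup>2 \<le> u * v"
  shows "w * c\<^sup>2 \<le> u * a\<^sup>2 + v * b\<^sup>2 + w * c\<^sup>2 - 2 * a * b * c"
proof (cases "u = 0")
  case True
  with c have "c = 0" by simp
  with True \<open>0 \<le> v\<close> show ?thesis by simp
next
  case False
  with \<open>0 \<le> u\<close> have "0 < u" by simp
  have "u * (u * a\<^sup>2 + v * b\<^sup>2 - 2 * a * b * c) = (u * a - b * c)\<^sup>2 + b\<^sup>2 * (u * v - c\<^sup>2)"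
    by algebra
  also have "\<dots> \<ge> 0" using c by simp
  finally show ?thesis using \<open>0 < u\<close> by (simp add: zero_le_mult_iff)
qed

text \<open>Cauchy-Schwarz for two binary variables, \<open>p\<close> being the mass where both are
  1; the defect is \<open>s\<close> times the third elementary symmetric polynomial.\<close>

lemma covariance_2x2_bound:
  fixes p q r z s m n :: real
  assumes nonneg: "0 \<le> p" "0 \<le> q" "0 \<le> r" "0 \<le> z"
    and sums: "s = p + q + r + z" "m = p + q" "n = p + r"
  shows "(s * p - m * n)\<^sup>2 \<le> (m * (s - m)) * (n * (s - n))"
proof -
  have "(m * (s - m)) * (n * (s - n)) - (s * p - m * n)\<^sup>2
      = s * (p * q * r + p * q * z + p * r * z + q * r * z)"
    unfolding sums by algebra
  also have "\<dots> \<ge> 0" using assms by simp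
  finally show ?thesis by simp
qed

text \<open>
  Expansion along the first row of the determinant of
  \<open>((s, m1, m2, m3), (m1, m1, m12, m13), (m2, m12, m2, m23), (m3, m13, m23, m3))\<close>,
  the Gram matrix of the constant \<open>1\<close> and three idempotents.
\<close>

definition gram_det :: "real \<Rightarrow> real \<Rightarrow> real \<Rightarrow> real \<Rightarrow> real \<Rightarrow> real \<Rightarrow> real \<Rightarrow> real" where
  "gram_det s m1 m2 m3 m12 m13 m23 =
     s * (m1 * m2 * m3 + 2 * m12 * m13 * m23 - m1 * m23\<^sup>2 - m2 * m13\<^sup>2 - m3 * m12\<^sup>2)
     - (m1\<^sup>2 * (m2 * m3 - m23\<^sup>2) + m2\<^sup>2 * (m1 * m3 - m13\<^sup>2) + m3\<^sup>2 * (m1 * m2 - m12\<^sup>2)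
        + 2 * m1 * m2 * (m13 * m23 - m12 * m3) + 2 * m1 * m3 * (m12 * m23 - m13 * m2)
        + 2 * m2 * m3 * (m12 * m13 - m1 * m23))"

text \<open>The right-hand side is the determinant of the Schur complement of \<open>s\<close>, scaled by \<open>s\<close>.\<close>

lemma gram_det_eq_covariance_det:
  fixes s m1 m2 m3 m12 m13 m23 :: real
  defines "u \<equiv> m1 * (s - m1)" and "v \<equiv> m2 * (s - m2)" and "w \<equiv> m3 * (s - m3)"
    and "a \<equiv> s * m23 - m2 * m3" and "b \<equiv> s * m13 - m1 * m3" and "c \<equiv> s * m12 - m1 * m2"
  shows "s\<^sup>2 * gram_det s m1 m2 m3 m12 m13 m23
       = u * v * w + 2 * a * b * c - u * a\<^sup>2 - v * b\<^sup>2 - w * c\<^sup>2"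
  unfolding gram_det_def u_def v_def w_def a_def b_def c_def by algebra

text \<open>Cauchy-Binet for the Gram matrix of the cube; the two large tetrahedra have coefficient \<open>2\<^sup>2\<close>.\<close>

lemma cube_gram_det:
  fixes x0 x1 x2 x3 x4 x5 x6 x7 :: real
  defines "s \<equiv> x0 + x1 + x2 + x3 + x4 + x5 + x6 + x7"
    and "m1 \<equiv> x4 + x5 + x6 + x7" and "m2 \<equiv> x2 + x3 + x6 + x7" and "m3 \<equiv> x1 + x3 + x5 + x7"
    and "m12 \<equiv> x6 + x7" and "m13 \<equiv> x5 + x7" and "m23 \<equiv> x3 + x7"
  shows "gram_det s m1 m2 m3 m12 m13 m23
       = (x0 + x1 + x2 + x3) * (x4 * x5 * x6 + x4 * x5 * x7 + x4 * x6 * x7 + x5 * x6 * x7)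
         + (x4 + x5 + x6 + x7) * (x0 * x1 * x2 + x0 * x1 * x3 + x0 * x2 * x3 + x1 * x2 * x3)
         + (x0 + x1) * (x2 + x3) * (x4 * x5 + x6 * x7)
         + (x0 + x2) * (x1 + x3) * (x4 * x6 + x5 * x7)
         + (x0 + x3) * (x1 + x2) * (x5 * x6 + x4 * x7)
         + 4 * x0 * x3 * x5 * x6 + 4 * x1 * x2 * x4 * x7"
  unfolding gram_det_def s_def m1_def m2_def m3_def m12_def m13_def m23_def by algebra

lemma pairwise_independent_no_zeros:
  fixes x0 x1 x2 x3 x4 x5 x6 x7 :: real
  defines "s \<equiv> x0 + x1 + x2 + x3 + x4 + x5 + x6 + x7"
    and "f0 \<equiv> x0 + x1 + x2 + x3" and "f1 \<equiv> x4 + x5 + x6 + x7"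
    and "g0 \<equiv> x0 + x1 + x4 + x5" and "g1 \<equiv> x2 + x3 + x6 + x7"
    and "h0 \<equiv> x0 + x2 + x4 + x6" and "h1 \<equiv> x1 + x3 + x5 + x7"
  assumes pos: "0 < f0" "0 < f1" "0 < g0" "0 < g1" "0 < h0" "0 < h1"
    and fg: "s * (x6 + x7) = f1 * g1" and fh: "s * (x5 + x7) = f1 * h1"
    and gh: "s * (x3 + x7) = g1 * h1"
    and even: "x0 * x3 * x5 * x6 = 0"
  shows "x1 * x2 * x4 * x7 \<noteq> 0"
proof
  assume odd: "x1 * x2 * x4 * x7 = 0"
  note defs = s_def f0_def f1_def g0_def g1_def h0_def h1_def
  \<comment> \<open>The weights on an edge add up to a pair marginal, a product by independence, so
    the deviation \<open>t\<close> changes sign along edges. The single marginals give the vertices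
    4, 2, 1, 0.\<close>
  define t where "t = s\<^sup>2 * x7 - f1 * g1 * h1"
  have e7: "s\<^sup>2 * x7 = f1 * g1 * h1 + t" by (simp add: t_def)
  have e6: "s\<^sup>2 * x6 = f1 * g1 * h0 - t" using fg unfolding t_def defs by algebra
  have e5: "s\<^sup>2 * x5 = f1 * g0 * h1 - t" using fh unfolding t_def defs by algebra
  have e3: "s\<^sup>2 * x3 = f0 * g1 * h1 - t" using gh unfolding t_def defs by algebra
  have s: "s = f0 + f1" "s = g0 + g1" "s = h0 + h1" by (simp_all add: defs)
  have e4: "s\<^sup>2 * x4 = f1 * g0 * h0 + t"
  proof -
    have "x4 = f1 - x5 - (x6 + x7)" by (simp add: defs)
    then have "s\<^sup>2 * x4 = s\<^sup>2 * f1 - s\<^sup>2 * x5 - s * (s * (x6 + x7))" by algebra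
    also have "\<dots> = f1 * g0 * h0 + t" unfolding e5 fg using s(2,3) by algebra
    finally show ?thesis .
  qed
  have e2: "s\<^sup>2 * x2 = f0 * g1 * h0 + t"
  proof -
    have "x2 = g1 - x6 - (x3 + x7)" by (simp add: defs)
    then have "s\<^sup>2 * x2 = s\<^sup>2 * g1 - s\<^sup>2 * x6 - s * (s * (x3 + x7))" by algebra
    also have "\<dots> = f0 * g1 * h0 + t" unfolding e6 gh using s(1,3) by algebra
    finally show ?thesis .
  qed
  have e1: "s\<^sup>2 * x1 = f0 * g0 * h1 + t"
  proof -
    have "x1 = h1 - x3 - (x5 + x7)" by (simp add: defs)
    then have "s\<^sup>2 * x1 = s\<^sup>2 * h1 - s\<^sup>2 * x3 - s * (s * (x5 + x7))" by algebra
    also have "\<dots> = f0 * g0 * h1 + t" unfolding e3 fh using s(1,2) by algebra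
    finally show ?thesis .
  qed
  have e0: "s\<^sup>2 * x0 = f0 * g0 * h0 - t"
  proof -
    have "x0 = f0 - x1 - x2 - x3" by (simp add: defs)
    then have "s\<^sup>2 * x0 = s\<^sup>2 * f0 - s\<^sup>2 * x1 - s\<^sup>2 * x2 - s\<^sup>2 * x3" by algebra
    also have "\<dots> = f0 * g0 * h0 - t" unfolding e1 e2 e3 using s(2,3) by algebra
    finally show ?thesis .
  qed
  have pr: "0 < f * g * h" if "f \<in> {f0, f1}" "g \<in> {g0, g1}" "h \<in> {h0, h1}" for f g h
    using that pos by auto
  \<comment> \<open>A zero weight here makes \<open>t\<close> equal to a positive product of
    marginals.\<close>
  have "0 < t"
    using even e0 e3 e5 e6 pr[of f0 g0 h0] pr[of f0 g1 h1] pr[of f1 g0 h1] pr[of f1 g1 h0] by auto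
  moreover have "t < 0"
    using odd e1 e2 e4 e7 pr[of f0 g0 h1] pr[of f0 g1 h0] pr[of f1 g0 h0] pr[of f1 g1 h1] by auto
  ultimately show False by simp
qed

lemma h_minus_expand:
  "h_minus x =
     (x$0 + x$1 + x$2 + x$3 + x$4 + x$5 + x$6 + x$7)\<^sup>2 *
     ((x$0 + x$1 + x$2 + x$3) * (x$4*x$5*x$6 + x$4*x$5*x$7 + x$4*x$6*x$7 + x$5*x$6*x$7)
      + (x$4 + x$5 + x$6 + x$7) * (x$0*x$1*x$2 + x$0*x$1*x$3 + x$0*x$2*x$3 + x$1*x$2*x$3)
      + (x$0 + x$1) * (x$2 + x$3) * (x$4 * x$5 + x$6 * x$7)
      + (x$0 + x$2) * (x$1 + x$3) * (x$4 * x$6 + x$5 * x$7)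
      + (x$0 + x$3) * (x$1 + x$2) * (x$5 * x$6 + x$4 * x$7)
      + 2 * x$0 * x$3 * x$5 * x$6 + 2 * x$1 * x$2 * x$4 * x$7)"
  unfolding h_minus_def triples_upper_8 triples_lower_8 intervals_8 by (simp add: add.assoc)

lemma h_plus_expand:
  "h_plus x =
     (x$0 + x$1 + x$2 + x$3) * (x$4 + x$5 + x$6 + x$7) *
     (x$0 + x$2 + x$4 + x$6) * (x$1 + x$3 + x$5 + x$7) *
     (x$0 + x$1 + x$4 + x$5) * (x$2 + x$3 + x$6 + x$7)"
  unfolding h_plus_def intervals_8 by (simp add: add.assoc)

lemma hypercube_equality_iff:
  fixes x :: "real^8"
  assumes nonneg: "\<And>i. 0 \<le> x$i"
  shows "h_minus x = h_plus x \<longleftrightarrow> (\<exists>F\<in>cube_facets. \<forall>i\<in>F. x$i = 0)"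
proof
  assume "\<exists>F\<in>cube_facets. \<forall>i\<in>F. x$i = 0"
  \<comment> \<open>Every nondegenerate tetrahedron meets each facet, as the opposite facet is
    planar.\<close>
  then show "h_minus x = h_plus x"
    unfolding cube_facets_def h_minus_expand h_plus_expand by auto
next
  assume eq: "h_minus x = h_plus x"
  define s where "s = x$0 + x$1 + x$2 + x$3 + x$4 + x$5 + x$6 + x$7"
  define m1 where "m1 = x$4 + x$5 + x$6 + x$7"
  define m2 where "m2 = x$2 + x$3 + x$6 + x$7"
  define m3 where "m3 = x$1 + x$3 + x$5 + x$7"
  define m12 where "m12 = x$6 + x$7"
  define m13 where "m13 = x$5 + x$7"
  define m23 where "m23 = x$3 + x$7"
  define u where "u = m1 * (s - m1)"
  define v where "v = m2 * (s - m2)"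
  define w where "w = m3 * (s - m3)"
  define a where "a = s * m23 - m2 * m3"
  define b where "b = s * m13 - m1 * m3"
  define c where "c = s * m12 - m1 * m2"
  define t_even where "t_even = x$0 * x$3 * x$5 * x$6"
  define t_odd where "t_odd = x$1 * x$2 * x$4 * x$7"
  define gap where "gap = u * a\<^sup>2 + v * b\<^sup>2 + w * c\<^sup>2 - 2 * a * b * c"
  note defs = s_def m1_def m2_def m3_def m12_def m13_def m23_def
  have compl: "s - m1 = x$0 + x$1 + x$2 + x$3" "s - m2 = x$0 + x$1 + x$4 + x$5"
    "s - m3 = x$0 + x$2 + x$4 + x$6"
    by (simp_all add: defs)
  have hp: "h_plus x = u * v * w"
    unfolding h_plus_expand u_def v_def w_def compl by (simp add: m1_def m2_def m3_def)
  have tetrahedra: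
    "A * (P + 2 * y0 * y3 * y5 * y6 + 2 * y1 * y2 * y4 * y7)
       + 2 * A * (y0 * y3 * y5 * y6 + y1 * y2 * y4 * y7)
     = A * (P + 4 * y0 * y3 * y5 * y6 + 4 * y1 * y2 * y4 * y7)"
    for A P y0 y1 y2 y3 y4 y5 y6 y7 :: real
    by algebra
  have "h_minus x + 2 * s\<^sup>2 * (t_even + t_odd) = s\<^sup>2 * gram_det s m1 m2 m3 m12 m13 m23"
    unfolding defs cube_gram_det h_minus_expand t_even_def t_odd_def by (rule tetrahedra)
  also have "\<dots> = u * v * w - gap"
    using gram_det_eq_covariance_det[of s m1 m2 m3 m12 m13 m23]
    unfolding u_def v_def w_def a_def b_def c_def gap_def by linarith
  finally have hm: "h_minus x + 2 * s\<^sup>2 * (t_even + t_odd) = u * v * w - gap" .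
  have uvw: "0 \<le> u" "0 \<le> v" "0 \<le> w"
    using nonneg unfolding u_def v_def w_def compl by (simp_all add: m1_def m2_def m3_def)
  have c2: "c\<^sup>2 \<le> u * v"
    unfolding c_def u_def v_def
    by (rule covariance_2x2_bound[where q="x$4 + x$5" and r="x$2 + x$3" and z="x$0 + x$1"])
      (simp_all add: defs nonneg)
  have b2: "b\<^sup>2 \<le> u * w"
    unfolding b_def u_def w_def
    by (rule covariance_2x2_bound[where q="x$4 + x$6" and r="x$1 + x$3" and z="x$0 + x$2"])
      (simp_all add: defs nonneg)
  have a2: "a\<^sup>2 \<le> v * w"
    unfolding a_def v_def w_def
    by (rule covariance_2x2_bound[where q="x$2 + x$6" and r="x$1 + x$5" and z="x$0 + x$4"])
      (simp_all add: defs nonneg)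
  have wc: "w * c\<^sup>2 \<le> gap"
    using hadamard_gap_3[OF uvw(1,2) c2, of w a b] by (simp add: gap_def)
  have vb: "v * b\<^sup>2 \<le> gap"
    using hadamard_gap_3[OF uvw(1,3) b2, of v a c] by (simp add: gap_def algebra_simps)
  have ua: "u * a\<^sup>2 \<le> gap"
    using hadamard_gap_3[OF uvw(2,3) a2, of u b c] by (simp add: gap_def algebra_simps)
  have nn: "0 \<le> w * c\<^sup>2" "0 \<le> v * b\<^sup>2" "0 \<le> u * a\<^sup>2" "0 \<le> t_even" "0 \<le> t_odd"
    using uvw nonneg by (simp_all add: t_even_def t_odd_def)
  then have "0 \<le> 2 * s\<^sup>2 * (t_even + t_odd)" by simp
  \<comment> \<open>Both losses are nonnegative and sum to
    \<open>h_plus x - h_minus x\<close>.\<close>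
  with hm hp eq wc nn have gap0: "gap = 0" and tet0: "2 * s\<^sup>2 * (t_even + t_odd) = 0"
    by linarith+
  show "\<exists>F\<in>cube_facets. \<forall>i\<in>F. x$i = 0"
  proof (rule ccontr)
    assume no: "\<not> ?thesis"
    have pos: "0 < x$i + x$j + x$k + x$l" if "{i,j,k,l} \<in> cube_facets" for i j k l
    proof -
      have "\<not> (\<forall>n\<in>{i,j,k,l}. x$n = 0)" using no by (rule contrapos_nn) (rule bexI[OF _ that])
      then have "\<not> (x$i = 0 \<and> x$j = 0 \<and> x$k = 0 \<and> x$l = 0)" by simp
      then show ?thesis
        using nonneg[of i] nonneg[of j] nonneg[of k] nonneg[of l] by linarith
    qed
    have p: "0 < x$0 + x$1 + x$2 + x$3" "0 < x$4 + x$5 + x$6 + x$7"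
      "0 < x$0 + x$1 + x$4 + x$5" "0 < x$2 + x$3 + x$6 + x$7"
      "0 < x$0 + x$2 + x$4 + x$6" "0 < x$1 + x$3 + x$5 + x$7"
      by (rule pos, simp add: cube_facets_def)+
    then have "0 < u" "0 < v" "0 < w"
      unfolding u_def v_def w_def compl by (simp_all add: m1_def m2_def m3_def)
    moreover have "w * c\<^sup>2 = 0" "v * b\<^sup>2 = 0" "u * a\<^sup>2 = 0"
      using gap0 wc vb ua nn by linarith+
    ultimately have abc: "a = 0" "b = 0" "c = 0" by simp_all
    have "0 < s" using p(1,2) by (simp add: s_def)
    with tet0 have "t_even + t_odd = 0" by simp
    with nn have tet: "t_even = 0" "t_odd = 0" by linarith+
    have "s * m12 = m1 * m2" "s * m13 = m1 * m3" "s * m23 = m2 * m3"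
      using abc by (simp_all add: a_def b_def c_def)
    from pairwise_independent_no_zeros[OF p this[unfolded defs] tet(1)[unfolded t_even_def]]
    show False using tet(2) by (simp add: t_odd_def)
  qed
qed

text \<open>
  Near a facet of vanishing weights the other facet obeys the two-dimensional inequality, which
  is an equality for equal weights; hence the ratio tends to 1 along \<open>(t,t,t,t,1,1,1,1)\<close>.
\<close>

lemma hypercube_tight:
  fixes c :: real
  assumes "c < 1"
  shows "\<exists>x::real^8. (\<forall>i. 0 \<le> x$i) \<and> c * h_plus x < h_minus x"
proof -
  \<comment> \<open>The ratio at the witness is \<open>1 - t / (4 * (1 + t)\<^sup>2)\<close>, which
    exceeds \<open>1 - t\<close>.\<close>
  define t where "t = 1 - c"
  have t: "0 < t" "c = 1 - t" using assms by (simp_all add: t_def)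
  define x :: "real^8" where "x = (\<chi> i. if i \<in> {0,1,2,3} then t else 1)"
  have x: "x$0 = t" "x$1 = t" "x$2 = t" "x$3 = t" "x$4 = 1" "x$5 = 1" "x$6 = 1" "x$7 = 1"
    by (simp_all add: x_def)
  have "h_minus x - c * h_plus x = 64 * t * (1 + t)\<^sup>2 * (3 * t + 8 * t\<^sup>2 + 4 * t^3)"
    unfolding h_minus_expand h_plus_expand x t(2) by algebra
  also have "\<dots> > 0" using t by (intro mult_pos_pos add_pos_pos) simp_all
  finally have "c * h_plus x < h_minus x" by simp
  moreover have "0 \<le> x$i" for i using t by (simp add: x_def)
  ultimately show ?thesis by blast
qed

theorem theorem6p2:
  shows "(\<forall>x::real^8. (\<forall>i. 0 \<le> x$i) \<longrightarrow>
            (h_minus x = h_plus x \<longleftrightarrow> (\<exists>F\<in>cube_facets. \<forall>i\<in>F. x$i = 0)))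
       \<and> \<not> (\<exists>c::real. 0 < c \<and> c < 1 \<and>
            (\<forall>x::real^8. (\<forall>i. 0 \<le> x$i) \<longrightarrow> h_minus x \<le> c * h_plus x))"
  using hypercube_equality_iff hypercube_tight by (meson not_le)

end
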